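(* Let $A=(B,O,S)$ be a cyclic or acyclic abduction instance. For $i\in\{1,2,\dots\}$ let $P_{\mathrm{BwdA}}^{P^i}(A)$ be the program obtained from the program $P_{\mathrm{BwdA}}(A)$ (defined in the context) by replacing every body atom of the form $Z_v=s(a,v,Y_1,\dots,Y_m)$ by the external atom $\&sk^{P^i}[a,v,Y_1,\dots,Y_m](Z_v)$. Then the ground instantiation $grnd(P_{\mathrm{BwdA}}^{P^i}(A))$ is finite for each $i\in\{1,2,\dots\}$.
   Context: **Abduction instances.** An abduction instance is a tuple $A=(B,O,S)$. Here $O$ (observation, goal) is an existentially quantified conjunction of atoms $\exists V_1,\dots,V_k: o_1(V_1,\dots,V_k)\wedge\cdots\wedge o_m(V_1,\dots,V_k)$, in which each existential variable $V_i$ is represented by a constant $v_i\notin S$. $B$ is a finite set of axioms, each a single-head Horn clause $$q(Y_1,\dots,Y_m)\Leftarrow p_1(X^1_1,\dots,X^1_{k_1})\wedge\cdots\wedge p_r(X^r_1,\dots,X^r_{k_r}),$$ with body variables $\mathcal X$, head variables $\mathcal Y\subseteq\mathcal X$, universally quantified over $\mathcal X$ (constants may also occur as arguments; they are left unchanged by the rewriting, and only head variables are arguments of Skolem terms). $S$ is a set of constants of $B$ called sort names. Here $B$ may be cyclic, i.e., circular inferences over the axioms are allowed. All atoms in $B$ and $O$ are assumed to have arity 2. **ASP program $P_{\mathrm{BwdA}}(A)=P_{bpt}(A)\cup P_{gp}\cup P_{eq}\cup P_c$.** An atom $p(a,b)$ is represented by the term $c(p,a,b)$. $P_{bpt}(A)$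 consists of: the fact $goal(c(o_i,v_1,\dots,v_k))$ for each atom of $O$; the fact $sortname(s)$ for each $s\in S$; for each axiom with unique identifier $a$ and $\{Z_1,\dots,Z_v\}=\mathcal X\setminus\mathcal Y$ the rules $$mayInferVia(a,c(q,Y_1,\dots,Y_m),l(Z_1,\dots,Z_v))\leftarrow pot(c(q,Y_1,\dots,Y_m)),\ Z_1=s(a,1,Y_1,\dots,Y_m),\dots,Z_v=s(a,v,Y_1,\dots,Y_m).$$ $$inferenceNeeds(c(q,Y_1,\dots,Y_m),a,c(p_j,X^j_1,\dots,X^j_{k_j}))\leftarrow mayInferVia(a,c(q,Y_1,\dots,Y_m),l(Z_1,\dots,Z_v)).\quad (1\le j\le r)$$ and the rules $pot(X)\leftarrow goal(X).$ and $pot(P)\leftarrow inferenceNeeds(\_,\_,P).$ $P_{gp}$ consists of $$true(P)\leftarrow goal(P).\qquad 1\le\{infer(P);fai(P)\}\le1\leftarrow true(P).$$ $$1\le\{inferVia(R,P): mayInferVia(R,P,\_)\}\le1\leftarrow infer(P).$$ $$true(Q)\leftarrow inferVia(R,P),\ inferenceNeeds(P,R,Q).$$ $P_{eq}$ consists of $$hu(X)\leftarrow pot(c(\_,X,\_)).\qquad hu(X)\leftarrow pot(c(\_,\_,X)).\qquad uhu(X)\leftarrow hu(X),\mathrm{not}\ sortname(X).$$ $$\{eq(A,B): uhu(A),uhu(B),A\neq B\}\leftarrow.\qquad eq(A,A)\leftarrow hu(A).$$ $$\leftarrow eq(A,B),\mathrm{not}\ eq(B,A).\qquad \leftarrow eq(A,B),eq(B,C),A\neq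 B,B\neq C,A\neq C,\mathrm{not}\ eq(A,C).$$ $P_c$ consists of $$factorCluster(c(P,S_2,O_2),c(P,S_1,O_1))\leftarrow fa(c(P,S_1,O_1)),fa(c(P,S_2,O_2)),eq(S_1,S_2),c(P,S_1,O_1)<c(P,S_2,O_2),eq(O_1,O_2).$$ $$factorClusterAbove(A)\leftarrow factorCluster(A,\_).$$ $$factorVia(A,B)\leftarrow factorCluster(A,B),\mathrm{not}\ factorClusterAbove(B).$$ $$factor(P)\leftarrow factorVia(P,\_).\qquad abduce(P)\leftarrow fa(P),\mathrm{not}\ factor(P).\qquad fa(P)\leftarrow fai(P).$$ Here $c$, $l$, $s$ are uninterpreted function symbols. **External atoms.** An external atom $\&f[\vec y](\vec x)$ (HEX programs) has its truth value determined by an oracle function $f(I,\vec y,\vec x)\in\{0,1\}$ for interpretation $I$ and ground input/output tuples. The oracle of $\&sk^{P^1}$ satisfies $f(I,R,V,Y_1,\dots,Y_m,Z)=1$ iff $Z=s(R,V,Y_1,\dots,Y_m)$ and no $Y_j$, $1\le j\le m$, is of the form $s(\cdot,\cdot,\cdots)$. The oracle of $\&sk^{P^2}$ equals $1$ iff $Z=s(R,V,Y_1,\dots,Y_m)$ and no $Y_j$ is of the form $s(\cdot,\cdot,U_1,\dots,U_k)$ with some $U_l$ of the form $s(\cdot,\cdot,\cdots)$. In general, the oracle of $\&sk^{P^i}$ equals $1$ iff $Z=s(R,V,Y_1,\dots,Y_m)$ and no $Y_j$ has, at nesting level $i-1$ (level $0$ being $Y_j$ itself), a subterm that is an invented value,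 i.e., of the form $s(\cdot,\cdot,\cdots)$. **Instantiation.** $grnd(P)$ is the ground instantiation of $P$ as produced by bottom-up instantiation of safe rules: the ground rule instances whose positive body atoms are derivable (possibly true) and whose external atoms evaluate to true. *)

theory Defs
  imports Main
begin

section \<open>Abduction instances\<close>

datatype const = Sym string | Num int

datatype arg = AVar string | ACon const

datatype batom = BAtom (pname: string) (arg1: arg) (arg2: arg)

record axm =
  ax_id :: const
  ax_head :: batom
  ax_body :: "batom list"

text \<open>\<open>ab_rep V\<close> is the constant that represents the existential variable \<open>V\<close> of the observation.\<close>

record abduction =
  ab_axioms :: "axm set"
  ab_obs :: "batom list"
  ab_rep :: "string \<Rightarrow> const"
  ab_sorts :: "const set"

fun arg_vars :: "arg \<Rightarrow> string list" where
  "arg_vars (AVar x) = [x]"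
| "arg_vars (ACon k) = []"

fun arg_consts :: "arg \<Rightarrow> const set" where
  "arg_consts (AVar x) = {}"
| "arg_consts (ACon k) = {k}"

definition batom_vars :: "batom \<Rightarrow> string list" where
  "batom_vars p = arg_vars (arg1 p) @ arg_vars (arg2 p)"

definition batom_consts :: "batom \<Rightarrow> const set" where
  "batom_consts p = arg_consts (arg1 p) \<union> arg_consts (arg2 p)"

definition head_vars :: "axm \<Rightarrow> string list" where
  "head_vars ax = batom_vars (ax_head ax)"

definition body_vars :: "axm \<Rightarrow> string list" where
  "body_vars ax = concat (map batom_vars (ax_body ax))"

text \<open>The order of the variables in \<open>Z\<^sub>1, \<dots>, Z\<^sub>v\<close> is immaterial; one enumeration is fixed here.\<close>

definition ex_vars :: "axm \<Rightarrow> string list" where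
  "ex_vars ax = filter (\<lambda>x. x \<notin> set (head_vars ax)) (remdups (body_vars ax))"

definition axm_consts :: "axm \<Rightarrow> const set" where
  "axm_consts ax = (\<Union>p \<in> set (ax_head ax # ax_body ax). batom_consts p)"

definition abduction_instance :: "abduction \<Rightarrow> bool" where
  "abduction_instance A \<longleftrightarrow>
     finite (ab_axioms A) \<and>
     inj_on ax_id (ab_axioms A) \<and>
     (\<forall>ax \<in> ab_axioms A. set (head_vars ax) \<subseteq> set (body_vars ax)) \<and>
     ab_sorts A \<subseteq> (\<Union>ax \<in> ab_axioms A. axm_consts ax) \<and>
     (\<forall>p \<in> set (ab_obs A). \<forall>V \<in> set (batom_vars p). ab_rep A V \<notin> ab_sorts A)"

section \<open>HEX programs\<close>

datatype fsym = FC | FL | FS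

datatype trm = Var string | Con const | Fn fsym "trm list"

datatype gtrm = GCon const | GFn fsym "gtrm list"

datatype psym = Goal | Sortname | MayInferVia | InferenceNeeds | Pot
  | Tru | Infer | Fai | InferVia
  | Hu | Uhu | Equ
  | FactorCluster | FactorClusterAbove | FactorVia | Factor | Abduce | Fa

datatype cmp = EqC | NeqC | LessC

text \<open>\<open>SkP i\<close> is the name of the external atom \<open>&sk\<close> of type \<open>P\<^sup>i\<close>.\<close>

datatype ext = SkP nat

datatype 't atm = Atm psym "'t list"

text \<open>\<open>Ext e ys xs\<close> has the input tuple \<open>ys\<close> and the output tuple \<open>xs\<close>.\<close>

datatype 't lit = Pos "'t atm" | Neg "'t atm" | Cmp cmp 't 't | Ext ext "'t list" "'t list"

text \<open>A choice head has optional bounds and a set of elements, each an atom with a condition.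
  It is a set, not a list, because an element of a rule expands to arbitrarily many ground elements.\<close>

datatype 't head =
    Normal "'t atm"
  | Choice "nat option" "('t atm \<times> 't lit list) set" "nat option"
  | Falsum

datatype 't rule = Rule (rhead: "'t head") (rbody: "'t lit list")

fun trm_vars :: "trm \<Rightarrow> string set" where
  "trm_vars (Var x) = {x}"
| "trm_vars (Con k) = {}"
| "trm_vars (Fn f ts) = (\<Union>t \<in> set ts. trm_vars t)"

fun inst :: "(string \<Rightarrow> gtrm) \<Rightarrow> trm \<Rightarrow> gtrm" where
  "inst \<sigma> (Var x) = \<sigma> x"
| "inst \<sigma> (Con k) = GCon k"
| "inst \<sigma> (Fn f ts) = GFn f (map (inst \<sigma>) ts)"

definition lits_vars :: "trm lit list \<Rightarrow> string set" where
  "lits_vars ls = (\<Union>l \<in> set ls. \<Union>t \<in> set_lit l. trm_vars t)"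

section \<open>Oracles\<close>

definition invented :: "gtrm \<Rightarrow> bool" where
  "invented t \<longleftrightarrow> (\<exists>R V Us. t = GFn FS (R # V # Us))"

fun invented_at :: "nat \<Rightarrow> gtrm \<Rightarrow> bool" where
  "invented_at 0 t \<longleftrightarrow> invented t"
| "invented_at (Suc n) t \<longleftrightarrow>
     (\<exists>R V Us. t = GFn FS (R # V # Us) \<and> (\<exists>U \<in> set Us. invented_at n U))"

fun ext_oracle :: "ext \<Rightarrow> gtrm atm set \<Rightarrow> gtrm list \<Rightarrow> gtrm list \<Rightarrow> bool" where
  "ext_oracle (SkP i) I ys xs \<longleftrightarrow>
     (\<exists>R V Ys Z. ys = R # V # Ys \<and> xs = [Z] \<and> Z = GFn FS (R # V # Ys) \<and>
        (\<forall>Y \<in> set Ys. \<not> invented_at (i - 1) Y))"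

section \<open>Ground instantiation\<close>

text \<open>\<open>ord\<close> is the order on ground terms that interprets the comparison \<open><\<close>.
  A default-negated atom never prevents an instance from being produced. An external atom is
  possibly true if its truth value is 1 under some interpretation.\<close>

fun possible :: "gtrm rel \<Rightarrow> gtrm atm set \<Rightarrow> gtrm lit \<Rightarrow> bool" where
  "possible ord D (Pos a) \<longleftrightarrow> a \<in> D"
| "possible ord D (Neg a) \<longleftrightarrow> True"
| "possible ord D (Cmp EqC s t) \<longleftrightarrow> s = t"
| "possible ord D (Cmp NeqC s t) \<longleftrightarrow> s \<noteq> t"
| "possible ord D (Cmp LessC s t) \<longleftrightarrow> (s, t) \<in> ord"
| "possible ord D (Ext e ys xs) \<longleftrightarrow> (\<exists>I. ext_oracle e I ys xs)"

abbreviation possible_inst ::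
  "gtrm rel \<Rightarrow> gtrm atm set \<Rightarrow> (string \<Rightarrow> gtrm) \<Rightarrow> trm lit list \<Rightarrow> bool" where
  "possible_inst ord D \<sigma> ls \<equiv> \<forall>l \<in> set ls. possible ord D (map_lit (inst \<sigma>) l)"

fun head_elems :: "'t head \<Rightarrow> ('t atm \<times> 't lit list) set" where
  "head_elems (Normal a) = {(a, [])}"
| "head_elems (Choice lb E ub) = E"
| "head_elems Falsum = {}"

definition step :: "gtrm rel \<Rightarrow> trm rule set \<Rightarrow> gtrm atm set \<Rightarrow> gtrm atm set" where
  "step ord P D =
     {map_atm (inst \<sigma>) a | \<sigma> a cond r.
        r \<in> P \<and> (a, cond) \<in> head_elems (rhead r) \<and>
        possible_inst ord D \<sigma> (rbody r) \<and> possible_inst ord D \<sigma> cond}"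

lemma mono_step: "mono (step ord P)"
proof (rule monoI)
  fix D D' :: "gtrm atm set"
  assume "D \<subseteq> D'"
  then have "possible ord D l \<Longrightarrow> possible ord D' l" for l
    by (cases "(ord, D, l)" rule: possible.cases) auto
  then show "step ord P D \<subseteq> step ord P D'"
    unfolding step_def by blast
qed

definition derivable :: "gtrm rel \<Rightarrow> trm rule set \<Rightarrow> gtrm atm set" where
  "derivable ord P = lfp (step ord P)"

text \<open>The variables of a choice element that do not occur in the body are local to the element:
  they are expanded within one ground rule.\<close>

fun inst_head :: "gtrm rel \<Rightarrow> gtrm atm set \<Rightarrow> string set \<Rightarrow> (string \<Rightarrow> gtrm) \<Rightarrow> trm head \<Rightarrow> gtrm head" where
  "inst_head ord D X \<sigma> (Normal a) = Normal (map_atm (inst \<sigma>) a)"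
| "inst_head ord D X \<sigma> (Choice lb E ub) =
     Choice lb
       {(map_atm (inst \<tau>) a, map (map_lit (inst \<tau>)) cond) | \<tau> a cond.
          (a, cond) \<in> E \<and> (\<forall>x \<in> X. \<tau> x = \<sigma> x) \<and> possible_inst ord D \<tau> cond}
       ub"
| "inst_head ord D X \<sigma> Falsum = Falsum"

definition inst_rule :: "gtrm rel \<Rightarrow> gtrm atm set \<Rightarrow> (string \<Rightarrow> gtrm) \<Rightarrow> trm rule \<Rightarrow> gtrm rule" where
  "inst_rule ord D \<sigma> r =
     Rule (inst_head ord D (lits_vars (rbody r)) \<sigma> (rhead r)) (map (map_lit (inst \<sigma>)) (rbody r))"

definition grnd :: "gtrm rel \<Rightarrow> trm rule set \<Rightarrow> gtrm rule set" where
  "grnd ord P =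
     {inst_rule ord (derivable ord P) \<sigma> r | \<sigma> r.
        r \<in> P \<and> possible_inst ord (derivable ord P) \<sigma> (rbody r)}"

text \<open>Finitely many ground rules do not suffice: \<open>{eq(A,B) : \<dots>}\<close> always yields a single
  ground rule, whose set of elements must be finite as well.\<close>

definition finite_program :: "'t rule set \<Rightarrow> bool" where
  "finite_program G \<longleftrightarrow> finite G \<and> (\<forall>r \<in> G. finite (head_elems (rhead r)))"

section \<open>The encoding of backward abduction\<close>

fun arg_trm :: "arg \<Rightarrow> trm" where
  "arg_trm (AVar x) = Var x"
| "arg_trm (ACon k) = Con k"

fun arg_goal :: "(string \<Rightarrow> const) \<Rightarrow> arg \<Rightarrow> trm" where
  "arg_goal rep (AVar x) = Con (rep x)"
| "arg_goal rep (ACon k) = Con k"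

definition cT :: "trm \<Rightarrow> trm \<Rightarrow> trm \<Rightarrow> trm" where
  "cT p a b = Fn FC [p, a, b]"

definition batom_trm :: "batom \<Rightarrow> trm" where
  "batom_trm p = cT (Con (Sym (pname p))) (arg_trm (arg1 p)) (arg_trm (arg2 p))"

definition goal_trm :: "(string \<Rightarrow> const) \<Rightarrow> batom \<Rightarrow> trm" where
  "goal_trm rep p = cT (Con (Sym (pname p))) (arg_goal rep (arg1 p)) (arg_goal rep (arg2 p))"

definition lT :: "axm \<Rightarrow> trm" where
  "lT ax = Fn FL (map Var (ex_vars ax))"

definition sT :: "axm \<Rightarrow> nat \<Rightarrow> trm" where
  "sT ax v = Fn FS (Con (ax_id ax) # Con (Num (int v)) # map Var (head_vars ax))"

definition mayInferVia_atm :: "axm \<Rightarrow> trm atm" where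
  "mayInferVia_atm ax = Atm MayInferVia [Con (ax_id ax), batom_trm (ax_head ax), lT ax]"

definition axm_rules :: "axm \<Rightarrow> trm rule set" where
  "axm_rules ax =
     {Rule (Normal (mayInferVia_atm ax))
        (Pos (Atm Pot [batom_trm (ax_head ax)]) #
         map (\<lambda>(v, z). Cmp EqC (Var z) (sT ax v)) (enumerate 1 (ex_vars ax)))}
     \<union> {Rule (Normal (Atm InferenceNeeds [batom_trm (ax_head ax), Con (ax_id ax), batom_trm p]))
          [Pos (mayInferVia_atm ax)] | p. p \<in> set (ax_body ax)}"

definition P_bpt :: "abduction \<Rightarrow> trm rule set" where
  "P_bpt A =
     {Rule (Normal (Atm Goal [goal_trm (ab_rep A) p])) [] | p. p \<in> set (ab_obs A)}
     \<union> {Rule (Normal (Atm Sortname [Con k])) [] | k. k \<in> ab_sorts A}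
     \<union> (\<Union>ax \<in> ab_axioms A. axm_rules ax)
     \<union> {Rule (Normal (Atm Pot [Var ''X''])) [Pos (Atm Goal [Var ''X''])],
        Rule (Normal (Atm Pot [Var ''P''])) [Pos (Atm InferenceNeeds [Var ''_1'', Var ''_2'', Var ''P''])]}"

definition P_gp :: "trm rule set" where
  "P_gp =
     {Rule (Normal (Atm Tru [Var ''P''])) [Pos (Atm Goal [Var ''P''])],
      Rule (Choice (Some 1) {(Atm Infer [Var ''P''], []), (Atm Fai [Var ''P''], [])} (Some 1))
        [Pos (Atm Tru [Var ''P''])],
      Rule (Choice (Some 1)
              {(Atm InferVia [Var ''R'', Var ''P''],
                [Pos (Atm MayInferVia [Var ''R'', Var ''P'', Var ''_1''])])}
              (Some 1))
        [Pos (Atm Infer [Var ''P''])],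
      Rule (Normal (Atm Tru [Var ''Q'']))
        [Pos (Atm InferVia [Var ''R'', Var ''P'']),
         Pos (Atm InferenceNeeds [Var ''P'', Var ''R'', Var ''Q''])]}"

definition P_eq :: "trm rule set" where
  "P_eq =
     {Rule (Normal (Atm Hu [Var ''X''])) [Pos (Atm Pot [cT (Var ''_1'') (Var ''X'') (Var ''_2'')])],
      Rule (Normal (Atm Hu [Var ''X''])) [Pos (Atm Pot [cT (Var ''_1'') (Var ''_2'') (Var ''X'')])],
      Rule (Normal (Atm Uhu [Var ''X''])) [Pos (Atm Hu [Var ''X'']), Neg (Atm Sortname [Var ''X''])],
      Rule (Choice None
              {(Atm Equ [Var ''A'', Var ''B''],
                [Pos (Atm Uhu [Var ''A'']), Pos (Atm Uhu [Var ''B'']), Cmp NeqC (Var ''A'') (Var ''B'')])}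
              None)
        [],
      Rule (Normal (Atm Equ [Var ''A'', Var ''A''])) [Pos (Atm Hu [Var ''A''])],
      Rule Falsum [Pos (Atm Equ [Var ''A'', Var ''B'']), Neg (Atm Equ [Var ''B'', Var ''A''])],
      Rule Falsum
        [Pos (Atm Equ [Var ''A'', Var ''B'']), Pos (Atm Equ [Var ''B'', Var ''C'']),
         Cmp NeqC (Var ''A'') (Var ''B''), Cmp NeqC (Var ''B'') (Var ''C''),
         Cmp NeqC (Var ''A'') (Var ''C''), Neg (Atm Equ [Var ''A'', Var ''C''])]}"

definition P_c :: "trm rule set" where
  "P_c =
     (let c1 = cT (Var ''P'') (Var ''S1'') (Var ''O1'');
          c2 = cT (Var ''P'') (Var ''S2'') (Var ''O2'')
      in
     {Rule (Normal (Atm FactorCluster [c2, c1]))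
        [Pos (Atm Fa [c1]), Pos (Atm Fa [c2]), Pos (Atm Equ [Var ''S1'', Var ''S2'']),
         Cmp LessC c1 c2, Pos (Atm Equ [Var ''O1'', Var ''O2''])],
      Rule (Normal (Atm FactorClusterAbove [Var ''A'']))
        [Pos (Atm FactorCluster [Var ''A'', Var ''_1''])],
      Rule (Normal (Atm FactorVia [Var ''A'', Var ''B'']))
        [Pos (Atm FactorCluster [Var ''A'', Var ''B'']), Neg (Atm FactorClusterAbove [Var ''B''])],
      Rule (Normal (Atm Factor [Var ''P''])) [Pos (Atm FactorVia [Var ''P'', Var ''_1''])],
      Rule (Normal (Atm Abduce [Var ''P''])) [Pos (Atm Fa [Var ''P'']), Neg (Atm Factor [Var ''P''])],
      Rule (Normal (Atm Fa [Var ''P''])) [Pos (Atm Fai [Var ''P''])]})"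

definition P_BwdA :: "abduction \<Rightarrow> trm rule set" where
  "P_BwdA A = P_bpt A \<union> P_gp \<union> P_eq \<union> P_c"

fun sk_lit :: "nat \<Rightarrow> trm lit \<Rightarrow> trm lit" where
  "sk_lit i (Cmp EqC (Var z) (Fn FS ts)) = Ext (SkP i) ts [Var z]"
| "sk_lit i l = l"

definition sk_rule :: "nat \<Rightarrow> trm rule \<Rightarrow> trm rule" where
  "sk_rule i r = Rule (rhead r) (map (sk_lit i) (rbody r))"

definition P_BwdA_P :: "nat \<Rightarrow> abduction \<Rightarrow> trm rule set" where
  "P_BwdA_P i A = sk_rule i ` P_BwdA A"

end

theory Submission
  imports Defs
begin

text \<open>An external atom of type \<open>P\<^sup>i\<close> rejects arguments with an invented value at nesting level
  \<open>i - 1\<close>, so every Skolem term that is created has nesting depth at most \<open>i\<close>. There are only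
  finitely many such terms over the constants of the instance. The atoms whose arguments are
  these terms, or applications of \<open>c\<close> or \<open>l\<close> to them, form a finite set that is closed under
  derivation, and every possibly applicable rule instance maps its variables into a finite set.\<close>

section \<open>Ground instances over a finite set of terms\<close>

definition atm_vars :: "trm atm \<Rightarrow> string set" where
  "atm_vars a = (\<Union>t \<in> set_atm a. trm_vars t)"

text \<open>The bound 3 is the largest arity of a predicate of the encoding, that of
  \<open>MayInferVia\<close> and \<open>InferenceNeeds\<close>.\<close>

definition atoms_over :: "gtrm set \<Rightarrow> gtrm atm set" where
  "atoms_over W = {Atm p ts | p ts. set ts \<subseteq> W \<and> length ts \<le> 3}"

text \<open>An invariant checked rule by rule, with \<open>atoms_over W\<close> in place of the
  derivable atoms. The closure of head atoms bounds derivation; the bound on variables leaves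
  finitely many instances. A choice element is judged together with its condition, which may be all
  that binds its variables.\<close>

definition confined :: "gtrm rel \<Rightarrow> gtrm set \<Rightarrow> trm rule \<Rightarrow> bool" where
  "confined ord W r \<longleftrightarrow> finite (head_elems (rhead r)) \<and>
     (\<forall>\<sigma>. possible_inst ord (atoms_over W) \<sigma> (rbody r) \<longrightarrow>
        \<sigma> ` lits_vars (rbody r) \<subseteq> W \<and>
        (\<forall>(a, cond) \<in> head_elems (rhead r). possible_inst ord (atoms_over W) \<sigma> cond \<longrightarrow>
           \<sigma> ` (atm_vars a \<union> lits_vars cond) \<subseteq> W \<and> map_atm (inst \<sigma>) a \<in> atoms_over W))"

lemma atoms_over_iff [simp]:
  "Atm p ts \<in> atoms_over W \<longleftrightarrow> set ts \<subseteq> W \<and> length ts \<le> 3"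
  by (auto simp: atoms_over_def)

lemma atm_vars_Atm [simp]: "atm_vars (Atm p ts) = (\<Union>t \<in> set ts. trm_vars t)"
  by (simp add: atm_vars_def)

lemma lits_vars_simps [simp]:
  "lits_vars [] = {}"
  "lits_vars (l # ls) = (\<Union>t \<in> set_lit l. trm_vars t) \<union> lits_vars ls"
  by (auto simp: lits_vars_def)

section \<open>Instances depend on finitely many variables\<close>

lemma finite_trm_vars: "finite (trm_vars t)"
  by (induction t) auto

lemma finite_atm_vars: "finite (atm_vars a)"
  by (cases a) (auto simp: finite_trm_vars)

lemma finite_lits_vars: "finite (lits_vars ls)"
proof -
  have "finite (set_lit l)" for l :: "trm lit"
  proof (cases l)
    case (Pos a) then show ?thesis by (cases a) simp
  next
    case (Neg a) then show ?thesis by (cases a) simp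
  qed auto
  then show ?thesis
    by (auto simp: lits_vars_def finite_trm_vars)
qed

lemma inst_cong: "(\<And>x. x \<in> trm_vars t \<Longrightarrow> \<sigma> x = \<tau> x) \<Longrightarrow> inst \<sigma> t = inst \<tau> t"
  by (induction t) auto

lemma map_atm_inst_cong:
  "(\<And>x. x \<in> atm_vars a \<Longrightarrow> \<sigma> x = \<tau> x) \<Longrightarrow> map_atm (inst \<sigma>) a = map_atm (inst \<tau>) a"
  by (auto simp: atm_vars_def intro!: atm.map_cong0 inst_cong)

lemma map_lits_inst_cong:
  "(\<And>x. x \<in> lits_vars ls \<Longrightarrow> \<sigma> x = \<tau> x) \<Longrightarrow>
    map (map_lit (inst \<sigma>)) ls = map (map_lit (inst \<tau>)) ls"
  by (auto simp: lits_vars_def intro!: lit.map_cong0 inst_cong)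

lemma possible_mono:
  assumes "possible ord D l" and "D \<subseteq> D'"
  shows "possible ord D' l"
  using assms by (cases "(ord, D, l)" rule: possible.cases) auto

text \<open>\<open>possible\<close> is monotone in the set of atoms, so confinement, stated for
  \<open>atoms_over W\<close>, carries over to every smaller set, such as the derivable
  atoms.\<close>

lemma confined_body_vars:
  assumes "confined ord W r" and "D \<subseteq> atoms_over W" and "possible_inst ord D \<sigma> (rbody r)"
  shows "\<sigma> ` lits_vars (rbody r) \<subseteq> W"
proof -
  have "possible_inst ord (atoms_over W) \<sigma> (rbody r)"
    using assms(2,3) possible_mono by blast
  then show ?thesis
    using assms(1) unfolding confined_def by blast
qed

lemma confined_head_elem:
  assumes r: "confined ord W r" and D: "D \<subseteq> atoms_over W"
    and "possible_inst ord D \<sigma> (rbody r)"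
    and "(a, cond) \<in> head_elems (rhead r)" and "possible_inst ord D \<sigma> cond"
  shows "\<sigma> ` (atm_vars a \<union> lits_vars cond) \<subseteq> W" and "map_atm (inst \<sigma>) a \<in> atoms_over W"
proof -
  have "possible_inst ord (atoms_over W) \<sigma> (rbody r)" "possible_inst ord (atoms_over W) \<sigma> cond"
    using assms(3,5) D possible_mono by blast+
  then show "\<sigma> ` (atm_vars a \<union> lits_vars cond) \<subseteq> W" "map_atm (inst \<sigma>) a \<in> atoms_over W"
    using r assms(4) unfolding confined_def by blast+
qed

section \<open>Counting ground instances\<close>

text \<open>\<open>F\<close> sees only the restriction of its argument to \<open>X\<close>, and
  there are finitely many maps from \<open>X\<close> to \<open>W\<close>.\<close>

lemma finite_image_assignments:
  assumes "finite X" and "finite W"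
    and dep: "\<And>\<sigma> \<tau>. (\<And>x. x \<in> X \<Longrightarrow> \<sigma> x = \<tau> x) \<Longrightarrow> F \<sigma> = F \<tau>"
  shows "finite (F ` {\<sigma>. \<sigma> ` X \<subseteq> W})"
proof (rule finite_surj)
  show "finite {f. \<forall>x. (x \<in> X \<longrightarrow> f x \<in> W) \<and> (x \<notin> X \<longrightarrow> f x = undefined)}"
    using assms by (intro finite_set_of_finite_funs)
  show "F ` {\<sigma>. \<sigma> ` X \<subseteq> W} \<subseteq>
      F ` {f. \<forall>x. (x \<in> X \<longrightarrow> f x \<in> W) \<and> (x \<notin> X \<longrightarrow> f x = undefined)}"
  proof (rule image_subsetI)
    fix \<sigma> assume s: "\<sigma> \<in> {\<sigma>. \<sigma> ` X \<subseteq> W}"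
    \<comment> \<open>Resetting the values outside \<open>X\<close> to \<open>undefined\<close>
      gives one representative for all assignments that agree on \<open>X\<close>.\<close>
    let ?f = "\<lambda>x. if x \<in> X then \<sigma> x else undefined"
    have "F \<sigma> = F ?f" by (rule dep) simp
    then show "F \<sigma> \<in> F ` {f. \<forall>x. (x \<in> X \<longrightarrow> f x \<in> W) \<and> (x \<notin> X \<longrightarrow> f x = undefined)}"
      using s by (intro image_eqI[of _ _ ?f]) auto
  qed
qed

text \<open>\<open>atoms_over W\<close> is closed under \<open>step\<close>, so the least fixed
  point lies below it.\<close>

lemma derivable_subset_atoms_over:
  assumes "\<And>r. r \<in> P \<Longrightarrow> confined ord W r"
  shows "derivable ord P \<subseteq> atoms_over W"
  unfolding derivable_def
proof (rule lfp_lowerbound, rule subsetI)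
  fix b assume "b \<in> step ord P (atoms_over W)"
  then show "b \<in> atoms_over W"
    using assms unfolding step_def confined_def by blast
qed

lemma finite_inst_rules:
  assumes "finite W" and r: "confined ord W r" and D: "D \<subseteq> atoms_over W"
  shows "finite {inst_rule ord D \<sigma> r | \<sigma>. possible_inst ord D \<sigma> (rbody r)}"
proof -
  \<comment> \<open>A normal head is instantiated by \<open>\<sigma>\<close> itself, so its
    variables count. For a choice head the body variables suffice: \<open>inst_head\<close> ranges
    over all assignments that agree with \<open>\<sigma>\<close> on them and sees nothing else of
    \<open>\<sigma>\<close>.\<close>
  define X where "X = lits_vars (rbody r) \<union>
    (case rhead r of Normal a \<Rightarrow> atm_vars a | _ \<Rightarrow> {})"
  have "{inst_rule ord D \<sigma> r | \<sigma>. possible_inst ord D \<sigma> (rbody r)}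
      \<subseteq> (\<lambda>\<sigma>. inst_rule ord D \<sigma> r) ` {\<sigma>. \<sigma> ` X \<subseteq> W}"
  proof clarify
    fix \<sigma> assume body: "possible_inst ord D \<sigma> (rbody r)"
    have "\<sigma> ` atm_vars a \<subseteq> W" if "rhead r = Normal a" for a
      using confined_head_elem(1)[OF r D body, of a "[]"] that by simp
    then have "\<sigma> ` X \<subseteq> W"
      using confined_body_vars[OF r D body] by (simp add: X_def image_Un split: head.split)
    then show "inst_rule ord D \<sigma> r \<in> (\<lambda>\<sigma>. inst_rule ord D \<sigma> r) ` {\<sigma>. \<sigma> ` X \<subseteq> W}"
      by blast
  qed
  moreover have "finite ((\<lambda>\<sigma>. inst_rule ord D \<sigma> r) ` {\<sigma>. \<sigma> ` X \<subseteq> W})"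
  proof (rule finite_image_assignments)
    show "finite X"
      unfolding X_def by (auto simp: finite_lits_vars finite_atm_vars split: head.splits)
    show "inst_rule ord D \<sigma> r = inst_rule ord D \<tau> r" if eq: "\<And>x. x \<in> X \<Longrightarrow> \<sigma> x = \<tau> x" for \<sigma> \<tau>
    proof -
      have "map (map_lit (inst \<sigma>)) (rbody r) = map (map_lit (inst \<tau>)) (rbody r)"
        by (rule map_lits_inst_cong) (simp add: eq X_def)
      moreover have "inst_head ord D (lits_vars (rbody r)) \<sigma> (rhead r) =
          inst_head ord D (lits_vars (rbody r)) \<tau> (rhead r)"
      proof (cases "rhead r")
        case (Normal a)
        then show ?thesis by (auto simp: X_def intro!: map_atm_inst_cong eq)
      next
        case (Choice lb E ub)
        then have "\<forall>x \<in> lits_vars (rbody r). \<sigma> x = \<tau> x"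
          by (simp add: eq X_def)
        then have "(\<forall>x \<in> lits_vars (rbody r). \<rho> x = \<sigma> x) \<longleftrightarrow>
            (\<forall>x \<in> lits_vars (rbody r). \<rho> x = \<tau> x)" for \<rho>
          by simp
        then show ?thesis by (simp add: Choice)
      qed simp
      ultimately show ?thesis by (simp add: inst_rule_def)
    qed
  qed fact
  ultimately show ?thesis by (rule finite_subset)
qed

text \<open>Each of the finitely many elements is expanded only by assignments that send its
  variables, local ones included, into \<open>W\<close>.\<close>

lemma finite_inst_head_elems:
  assumes "finite W" and r: "confined ord W r" and D: "D \<subseteq> atoms_over W"
    and body: "possible_inst ord D \<sigma> (rbody r)"
  shows "finite (head_elems (rhead (inst_rule ord D \<sigma> r)))"
proof (cases "rhead r")
  case (Choice lb E ub)
  define F where "F a cond \<tau> = (map_atm (inst \<tau>) a, map (map_lit (inst \<tau>)) cond)"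
    for a cond \<tau>
  have fin: "finite (F a cond ` {\<tau>. \<tau> ` (atm_vars a \<union> lits_vars cond) \<subseteq> W})" for a cond
  proof (rule finite_image_assignments)
    show "F a cond \<sigma> = F a cond \<tau>"
      if "\<And>x. x \<in> atm_vars a \<union> lits_vars cond \<Longrightarrow> \<sigma> x = \<tau> x" for \<sigma> \<tau>
      unfolding F_def using that map_atm_inst_cong[of a \<sigma> \<tau>] map_lits_inst_cong[of cond \<sigma> \<tau>]
      by simp
  qed (simp_all add: finite_lits_vars finite_atm_vars \<open>finite W\<close>)
  have "head_elems (rhead (inst_rule ord D \<sigma> r)) \<subseteq>
      (\<Union>(a, cond) \<in> E. F a cond ` {\<tau>. \<tau> ` (atm_vars a \<union> lits_vars cond) \<subseteq> W})"
  proof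
    fix e assume "e \<in> head_elems (rhead (inst_rule ord D \<sigma> r))"
    then obtain \<tau> a cond where e: "e = F a cond \<tau>" and E: "(a, cond) \<in> E"
      and eq: "\<forall>x \<in> lits_vars (rbody r). \<tau> x = \<sigma> x" and cond: "possible_inst ord D \<tau> cond"
      by (auto simp: inst_rule_def Choice F_def)
    \<comment> \<open>\<open>\<tau>\<close> may differ from \<open>\<sigma>\<close> on local
      variables, but the body instance is the same, so confinement applies to \<open>\<tau>\<close>
      itself.\<close>
    have "map (map_lit (inst \<tau>)) (rbody r) = map (map_lit (inst \<sigma>)) (rbody r)"
      using eq by (intro map_lits_inst_cong) simp
    then have "map_lit (inst \<tau>) l = map_lit (inst \<sigma>) l" if "l \<in> set (rbody r)" for l
      using that by (simp only: map_eq_conv)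
    with body have "possible_inst ord D \<tau> (rbody r)"
      by simp
    moreover have "(a, cond) \<in> head_elems (rhead r)"
      using E Choice by simp
    ultimately have "\<tau> ` (atm_vars a \<union> lits_vars cond) \<subseteq> W"
      using confined_head_elem(1)[OF r D] cond by blast
    then show "e \<in> (\<Union>(a, cond) \<in> E. F a cond ` {\<tau>. \<tau> ` (atm_vars a \<union> lits_vars cond) \<subseteq> W})"
      using e E by blast
  qed
  moreover have "finite E"
    using r Choice by (simp add: confined_def)
  ultimately show ?thesis
    using fin by (auto elim!: finite_subset)
qed (simp_all add: inst_rule_def)

text \<open>The interface to the encoding: what remains is to find one finite \<open>W\<close> that
  confines every rule.\<close>

lemma finite_program_grnd:
  assumes "finite P" and "finite W" and P: "\<And>r. r \<in> P \<Longrightarrow> confined ord W r"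
  shows "finite_program (grnd ord P)"
proof -
  have D: "derivable ord P \<subseteq> atoms_over W"
    using P by (rule derivable_subset_atoms_over)
  have "grnd ord P = (\<Union>r \<in> P. {inst_rule ord (derivable ord P) \<sigma> r | \<sigma>.
      possible_inst ord (derivable ord P) \<sigma> (rbody r)})"
    unfolding grnd_def by blast
  then have "finite (grnd ord P)"
    using finite_inst_rules[OF \<open>finite W\<close> P D] \<open>finite P\<close> by simp
  moreover have "finite (head_elems (rhead g))" if "g \<in> grnd ord P" for g
  proof -
    obtain \<sigma> r where "g = inst_rule ord (derivable ord P) \<sigma> r" and "r \<in> P"
      and "possible_inst ord (derivable ord P) \<sigma> (rbody r)"
      using \<open>g \<in> grnd ord P\<close> unfolding grnd_def by blast
    then show ?thesis
      using finite_inst_head_elems[OF \<open>finite W\<close> P D] by simp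
  qed
  ultimately show ?thesis
    by (simp add: finite_program_def)
qed

section \<open>Skolem terms of bounded depth\<close>

text \<open>Skolem terms nested at most \<open>n\<close> deep. \<open>a\<close> is an axiom
  identifier and \<open>v\<close> the index of an existential variable, hence constants;
  \<open>ts\<close> has at most two entries because heads are binary.\<close>

fun skolem_terms :: "const set \<Rightarrow> nat \<Rightarrow> gtrm set" where
  "skolem_terms K 0 = GCon ` K"
| "skolem_terms K (Suc n) = GCon ` K \<union>
     {GFn FS (GCon a # GCon v # ts) | a v ts.
        a \<in> K \<and> v \<in> K \<and> set ts \<subseteq> skolem_terms K n \<and> length ts \<le> 2}"

text \<open>The possible arguments of atoms: Skolem terms, or a single \<open>c\<close> or
  \<open>l\<close> on top of them. \<open>N\<close> bounds the width, which for \<open>l\<close> is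
  the number of existential variables of an axiom.\<close>

definition universe :: "const set \<Rightarrow> nat \<Rightarrow> nat \<Rightarrow> gtrm set" where
  "universe K N n = skolem_terms K n \<union>
     {GFn f ts | f ts. f \<noteq> FS \<and> set ts \<subseteq> skolem_terms K n \<and> length ts \<le> N}"

lemma finite_skolem_terms: "finite K \<Longrightarrow> finite (skolem_terms K n)"
proof (induction n)
  case (Suc n)
  have "{GFn FS (GCon a # GCon v # ts) | a v ts.
        a \<in> K \<and> v \<in> K \<and> set ts \<subseteq> skolem_terms K n \<and> length ts \<le> 2} =
      (\<lambda>(a, v, ts). GFn FS (GCon a # GCon v # ts)) `
        (K \<times> K \<times> {ts. set ts \<subseteq> skolem_terms K n \<and> length ts \<le> 2})"
    unfolding image_def by auto
  then show ?case
    using Suc finite_lists_length_le[of "skolem_terms K n" 2] by simp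
qed simp

lemma finite_universe: "finite K \<Longrightarrow> finite (universe K N n)"
proof -
  assume K: "finite K"
  have "{GFn f ts | f ts. f \<noteq> FS \<and> set ts \<subseteq> skolem_terms K n \<and> length ts \<le> N} \<subseteq>
      (\<lambda>(f, ts). GFn f ts) ` ({FC, FL} \<times> {ts. set ts \<subseteq> skolem_terms K n \<and> length ts \<le> N})"
    by (auto intro: fsym.exhaust)
  then show ?thesis
    unfolding universe_def
    using finite_skolem_terms[OF K] finite_lists_length_le[OF finite_skolem_terms[OF K]]
    by (auto elim: finite_subset)
qed

lemma GCon_in_skolem_terms: "k \<in> K \<Longrightarrow> GCon k \<in> skolem_terms K n"
  by (cases n) auto

lemma skolem_terms_subset_universe: "t \<in> skolem_terms K n \<Longrightarrow> t \<in> universe K N n"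
  by (simp add: universe_def)

text \<open>An equivalence, since no member of \<open>skolem_terms\<close> is headed by
  \<open>c\<close> or \<open>l\<close>: such a term in the universe gives back the depth bound for
  its arguments.\<close>

lemma GFn_in_universe:
  "f \<noteq> FS \<Longrightarrow> GFn f ts \<in> universe K N n \<longleftrightarrow> set ts \<subseteq> skolem_terms K n \<and> length ts \<le> N"
  by (cases n) (auto simp: universe_def)

text \<open>A Skolem term that is not invented at level 0 is a constant. If nothing is invented at
  level \<open>Suc m\<close>, then no entry of \<open>ts\<close> has an invented value at level
  \<open>m\<close>, so by induction these entries have depth at most \<open>m\<close>.\<close>

lemma not_invented_at_skolem_terms:
  "t \<in> skolem_terms K n \<Longrightarrow> \<not> invented_at m t \<Longrightarrow> t \<in> skolem_terms K m"
proof (induction m arbitrary: t n)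
  case 0
  then show ?case by (cases n) (auto simp: invented_def)
next
  case (Suc m)
  show ?case
  proof (cases n)
    case 0
    then show ?thesis using Suc.prems by auto
  next
    case (Suc n')
    then show ?thesis using Suc.prems Suc.IH by fastforce
  qed
qed

text \<open>Why the depth stays bounded on cycles: the oracle accepts only arguments of depth at
  most \<open>i - 1\<close>, and the new term adds one level.\<close>

lemma skolem_oracle_in_skolem_terms:
  assumes "ext_oracle (SkP i) I (GCon a # GCon v # ts) [z]" and "i \<ge> 1"
    and "a \<in> K" "v \<in> K" and "set ts \<subseteq> skolem_terms K i" and "length ts \<le> 2"
  shows "z \<in> skolem_terms K i"
proof -
  \<comment> \<open>Subtraction on \<open>nat\<close> truncates at 0; \<open>i \<ge> 1\<close> makes
    \<open>i - 1\<close> a true predecessor.\<close>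
  obtain m where m: "i = Suc m"
    using \<open>i \<ge> 1\<close> by (cases i) auto
  have "set ts \<subseteq> skolem_terms K m"
    using assms m not_invented_at_skolem_terms by fastforce
  then show ?thesis
    using assms m by auto
qed

section \<open>The encoding\<close>

text \<open>Predicate names are included because \<open>p(a,b)\<close> is encoded as the term
  \<open>c(p,a,b)\<close>. The indices in Skolem terms run from 1 to
  \<open>length (ex_vars ax)\<close>, which the closed range covers.\<close>

definition instance_consts :: "abduction \<Rightarrow> const set" where
  "instance_consts A =
     ab_sorts A \<union>
     (\<Union>ax \<in> ab_axioms A. insert (ax_id ax) (axm_consts ax \<union>
        (\<lambda>p. Sym (pname p)) ` set (ax_head ax # ax_body ax) \<union>
        (\<lambda>v. Num (int v)) ` {..length (ex_vars ax)})) \<union>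
     (\<Union>p \<in> set (ab_obs A). insert (Sym (pname p)) (batom_consts p \<union> ab_rep A ` set (batom_vars p)))"

lemma finite_batom_consts: "finite (batom_consts p)"
proof -
  have "finite (arg_consts u)" for u by (cases u) auto
  then show ?thesis by (simp add: batom_consts_def)
qed

lemma finite_instance_consts:
  assumes "abduction_instance A"
  shows "finite (instance_consts A)"
proof -
  have ax: "finite (axm_consts ax)" for ax
    by (simp add: axm_consts_def finite_batom_consts)
  \<comment> \<open>Sort names are constants of the finitely many axioms.\<close>
  then have "finite (ab_sorts A)"
    using assms unfolding abduction_instance_def by (auto elim: finite_subset)
  then show ?thesis
    using assms ax by (simp add: instance_consts_def abduction_instance_def finite_batom_consts)
qed

lemma finite_P_BwdA:
  assumes "abduction_instance A"
  shows "finite (P_BwdA A)"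
proof -
  have ax: "finite (axm_rules ax)" for ax
    by (auto simp: axm_rules_def)
  have "finite (ab_sorts A)"
    using finite_instance_consts[OF assms] by (simp add: instance_consts_def)
  then have "finite (P_bpt A)"
    using assms ax by (auto simp: P_bpt_def abduction_instance_def)
  then show ?thesis
    by (auto simp: P_BwdA_def P_gp_def P_eq_def P_c_def Let_def)
qed

section \<open>Encoded atoms as members of the universe\<close>

text \<open>Read from left to right for body atoms, to bound their variables, and from right to left
  for head atoms, to place them in the universe.\<close>

lemma inst_batom_trm_in_universe:
  assumes "3 \<le> N" and "Sym (pname p) \<in> K" and "batom_consts p \<subseteq> K"
  shows "inst \<sigma> (batom_trm p) \<in> universe K N n \<longleftrightarrow>
    \<sigma> ` set (batom_vars p) \<subseteq> skolem_terms K n"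
  using assms
  by (cases p; cases "arg1 p"; cases "arg2 p")
    (auto simp: batom_trm_def cT_def batom_vars_def batom_consts_def GFn_in_universe
      GCon_in_skolem_terms)

lemma trm_vars_batom_trm: "trm_vars (batom_trm p) = set (batom_vars p)"
  by (cases p; cases "arg1 p"; cases "arg2 p") (auto simp: batom_trm_def cT_def batom_vars_def)

lemma inst_goal_trm_in_universe:
  assumes "3 \<le> N" and "Sym (pname p) \<in> K" and "batom_consts p \<subseteq> K"
    and "rep ` set (batom_vars p) \<subseteq> K"
  shows "inst \<sigma> (goal_trm rep p) \<in> universe K N n"
  using assms
  by (cases p; cases "arg1 p"; cases "arg2 p")
    (auto simp: goal_trm_def cT_def batom_vars_def batom_consts_def GFn_in_universe
      GCon_in_skolem_terms)

lemma trm_vars_goal_trm: "trm_vars (goal_trm rep p) = {}"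
  by (cases p; cases "arg1 p"; cases "arg2 p") (auto simp: goal_trm_def cT_def)

lemma length_head_vars: "length (head_vars ax) \<le> 2"
proof -
  have "length (arg_vars u) \<le> 1" for u by (cases u) auto
  from this[of "arg1 (ax_head ax)"] this[of "arg2 (ax_head ax)"] show ?thesis
    by (simp add: head_vars_def batom_vars_def)
qed

lemma body_vars_subset: "p \<in> set (ax_body ax) \<Longrightarrow>
    set (batom_vars p) \<subseteq> set (head_vars ax) \<union> set (ex_vars ax)"
  by (auto simp: ex_vars_def body_vars_def)

section \<open>Confinement of the rules of the encoding\<close>

text \<open>The only rules that can create Skolem terms are here. In the \<open>MayInferVia\<close>
  rule, the \<open>Pot\<close> atom bounds the head variables and the external atoms bound the
  rest.\<close>

lemma confined_axm_rules:
  fixes N :: nat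
  assumes r: "r \<in> axm_rules ax" and i: "i \<ge> 1"
    and N: "3 \<le> N" "length (ex_vars ax) \<le> N"
    and K: "ax_id ax \<in> K" "axm_consts ax \<subseteq> K"
      "\<And>p. p \<in> set (ax_head ax # ax_body ax) \<Longrightarrow> Sym (pname p) \<in> K"
      "\<And>v. v \<le> length (ex_vars ax) \<Longrightarrow> Num (int v) \<in> K"
  shows "confined ord (universe K N i) (sk_rule i r)"
proof -
  let ?W = "universe K N i" and ?T = "skolem_terms K i"
  have TW: "?T \<subseteq> ?W"
    using skolem_terms_subset_universe by blast
  have id: "GCon (ax_id ax) \<in> ?W"
    using K(1) GCon_in_skolem_terms skolem_terms_subset_universe by blast
  have at: "inst \<sigma> (batom_trm p) \<in> ?W \<longleftrightarrow> \<sigma> ` set (batom_vars p) \<subseteq> ?T"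
    if "p \<in> set (ax_head ax # ax_body ax)" for p \<sigma>
    using that K(2) by (intro inst_batom_trm_in_universe N K(3)) (auto simp: axm_consts_def)
  have hd: "inst \<sigma> (batom_trm (ax_head ax)) \<in> ?W \<longleftrightarrow> \<sigma> ` set (head_vars ax) \<subseteq> ?T" for \<sigma>
    using at[of "ax_head ax"] by (simp add: head_vars_def)
  have l: "inst \<sigma> (lT ax) \<in> ?W \<longleftrightarrow> \<sigma> ` set (ex_vars ax) \<subseteq> ?T" for \<sigma>
    using N by (auto simp: lT_def GFn_in_universe)
  have hv: "trm_vars (batom_trm (ax_head ax)) = set (head_vars ax)"
    by (simp add: trm_vars_batom_trm head_vars_def)
  have lv: "trm_vars (lT ax) = set (ex_vars ax)"
    by (auto simp: lT_def)
  \<comment> \<open>The external atom that \<open>sk_lit i\<close> makes of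
    \<open>Z = s(a,v,Y)\<close>: the arguments of \<open>s\<close> become the input,
    \<open>Z\<close> the output.\<close>
  define sk where "sk = (\<lambda>(v, z). Ext (SkP i)
    (Con (ax_id ax) # Con (Num (int v)) # map Var (head_vars ax)) [Var z])"
  have sk: "map (sk_lit i) (map (\<lambda>(v, z). Cmp EqC (Var z) (sT ax v)) ps) = map sk ps" for ps
    by (induction ps) (auto simp: sk_def sT_def)
  consider (may) "sk_rule i r = Rule (Normal (mayInferVia_atm ax))
        (Pos (Atm Pot [batom_trm (ax_head ax)]) # map sk (enumerate 1 (ex_vars ax)))"
    | (needs) p where "p \<in> set (ax_body ax)" "sk_rule i r =
        Rule (Normal (Atm InferenceNeeds [batom_trm (ax_head ax), Con (ax_id ax), batom_trm p]))
          [Pos (mayInferVia_atm ax)]"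
    using r by (auto simp: axm_rules_def sk_rule_def sk simp del: map_map)
  then show ?thesis
  proof cases
    case may
    have vars: "lits_vars (map sk ps) \<subseteq> set (head_vars ax) \<union> snd ` set ps" for ps
      by (induction ps) (auto simp: sk_def)
    have "snd ` set (enumerate 1 (ex_vars ax)) = set (ex_vars ax)"
      by (metis list.set_map map_snd_enumerate)
    then have sk_vars: "lits_vars (map sk (enumerate 1 (ex_vars ax))) \<subseteq>
        set (head_vars ax) \<union> set (ex_vars ax)"
      using vars[of "enumerate 1 (ex_vars ax)"] by simp
    have ev: "\<sigma> ` set (ex_vars ax) \<subseteq> ?T"
      if hT: "\<sigma> ` set (head_vars ax) \<subseteq> ?T"
        and ext: "possible_inst ord (atoms_over ?W) \<sigma> (map sk (enumerate 1 (ex_vars ax)))" for \<sigma>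
    proof clarify
      fix z assume "z \<in> set (ex_vars ax)"
      then obtain j where j: "j < length (ex_vars ax)" "z = ex_vars ax ! j"
        by (auto simp: in_set_conv_nth)
      \<comment> \<open>List positions start at 0, Skolem indices at 1.\<close>
      then have "(Suc j, z) \<in> set (enumerate 1 (ex_vars ax))"
        by (auto simp: in_set_enumerate_eq)
      then have "possible ord (atoms_over ?W) (map_lit (inst \<sigma>) (sk (Suc j, z)))"
        using ext by simp
      then obtain I where "ext_oracle (SkP i) I
          (GCon (ax_id ax) # GCon (Num (int (Suc j))) # map \<sigma> (head_vars ax)) [\<sigma> z]"
        by (auto simp: sk_def comp_def)
      then show "\<sigma> z \<in> ?T"
        using j hT by (intro skolem_oracle_in_skolem_terms[OF _ i K(1) K(4)[of "Suc j"]])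
          (auto simp: length_head_vars)
    qed
    show ?thesis
      unfolding confined_def
    proof (intro conjI allI impI ballI)
      fix \<sigma> assume body: "possible_inst ord (atoms_over ?W) \<sigma> (rbody (sk_rule i r))"
      then have h: "\<sigma> ` set (head_vars ax) \<subseteq> ?T"
        and ext: "possible_inst ord (atoms_over ?W) \<sigma> (map sk (enumerate 1 (ex_vars ax)))"
        unfolding may by (simp_all add: hd)
      note e = ev[OF h ext]
      have hW: "\<sigma> ` set (head_vars ax) \<subseteq> ?W" and eW: "\<sigma> ` set (ex_vars ax) \<subseteq> ?W"
        using h e TW by blast+
      show "\<sigma> ` lits_vars (rbody (sk_rule i r)) \<subseteq> ?W"
        using hW subset_trans[OF image_mono[OF sk_vars, of \<sigma>], of ?W] eW
        unfolding may by (simp add: hv image_Un)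
      show "case x of (a, cond) \<Rightarrow> possible_inst ord (atoms_over ?W) \<sigma> cond \<longrightarrow>
          \<sigma> ` (atm_vars a \<union> lits_vars cond) \<subseteq> ?W \<and> map_atm (inst \<sigma>) a \<in> atoms_over ?W"
        if "x \<in> head_elems (rhead (sk_rule i r))" for x
        using that h e hW eW unfolding may
        by (simp add: mayInferVia_atm_def hv lv hd l id image_Un)
    qed (simp add: may)
  next
    case needs
    have p: "inst \<sigma> (batom_trm p) \<in> ?W \<longleftrightarrow> \<sigma> ` set (batom_vars p) \<subseteq> ?T" for \<sigma>
      using needs(1) by (intro at) simp
    show ?thesis
      unfolding confined_def
    proof (intro conjI allI impI ballI)
      fix \<sigma> assume body: "possible_inst ord (atoms_over ?W) \<sigma> (rbody (sk_rule i r))"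
      \<comment> \<open>The \<open>MayInferVia\<close> atom carries all variables of the axiom: its
        \<open>c\<close> term bounds those of the head, its \<open>l\<close> term the existential
        ones.\<close>
      then have h: "\<sigma> ` set (head_vars ax) \<subseteq> ?T" and e: "\<sigma> ` set (ex_vars ax) \<subseteq> ?T"
        unfolding needs(2) by (simp_all add: mayInferVia_atm_def hd l)
      have v: "\<sigma> ` set (batom_vars p) \<subseteq> ?T"
        using h e body_vars_subset[OF needs(1)] by blast
      have W: "\<sigma> ` set (head_vars ax) \<subseteq> ?W" "\<sigma> ` set (ex_vars ax) \<subseteq> ?W"
        "\<sigma> ` set (batom_vars p) \<subseteq> ?W"
        using h e v TW by blast+
      show "\<sigma> ` lits_vars (rbody (sk_rule i r)) \<subseteq> ?W"
        using W unfolding needs(2) by (simp add: mayInferVia_atm_def hv lv image_Un)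
      show "case x of (a, cond) \<Rightarrow> possible_inst ord (atoms_over ?W) \<sigma> cond \<longrightarrow>
          \<sigma> ` (atm_vars a \<union> lits_vars cond) \<subseteq> ?W \<and> map_atm (inst \<sigma>) a \<in> atoms_over ?W"
        if "x \<in> head_elems (rhead (sk_rule i r))" for x
        using that h v W unfolding needs(2)
        by (simp add: trm_vars_batom_trm[of p] hv hd p id image_Un)
    qed (simp add: needs(2))
  qed
qed

text \<open>Apart from the ground facts and the axiom rules, every variable occurs in a positive
  body or condition atom, and every compound term in a head already occurs in the body.\<close>

lemma confined_P_BwdA_P:
  assumes "r \<in> P_BwdA_P i A" and i: "i \<ge> 1" and N: "3 \<le> N"
    and ex: "\<And>ax. ax \<in> ab_axioms A \<Longrightarrow> length (ex_vars ax) \<le> N"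
  shows "confined ord (universe (instance_consts A) N i) r"
proof -
  let ?K = "instance_consts A"
  let ?W = "universe ?K N i"
  obtain r' where r': "r' \<in> P_BwdA A" and r: "r = sk_rule i r'"
    using assms(1) by (auto simp: P_BwdA_P_def)
  \<comment> \<open>Matching a \<open>c\<close> term exposes its arguments, as in the
    \<open>Hu\<close> rules; these are again in the universe.\<close>
  have c: "GFn FC [x, y, z] \<in> ?W \<longleftrightarrow>
      x \<in> skolem_terms ?K i \<and> y \<in> skolem_terms ?K i \<and> z \<in> skolem_terms ?K i" for x y z
    using N by (simp add: GFn_in_universe)
  note simps = confined_def sk_rule_def cT_def c skolem_terms_subset_universe
  consider p where "p \<in> set (ab_obs A)" "r' = Rule (Normal (Atm Goal [goal_trm (ab_rep A) p])) []"
    | k where "k \<in> ab_sorts A" "r' = Rule (Normal (Atm Sortname [Con k])) []"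
    | ax where "ax \<in> ab_axioms A" "r' \<in> axm_rules ax"
    | "r' \<in> {Rule (Normal (Atm Pot [Var ''X''])) [Pos (Atm Goal [Var ''X''])],
        Rule (Normal (Atm Pot [Var ''P''])) [Pos (Atm InferenceNeeds [Var ''_1'', Var ''_2'', Var ''P''])]}"
    | "r' \<in> P_gp" | "r' \<in> P_eq" | "r' \<in> P_c"
    using r' by (auto simp: P_BwdA_def P_bpt_def)
  then show ?thesis
  proof cases
    case (1 p)
    then have "inst \<sigma> (goal_trm (ab_rep A) p) \<in> ?W" for \<sigma>
      by (intro inst_goal_trm_in_universe N) (auto simp: instance_consts_def)
    then show ?thesis
      by (simp add: r 1 simps trm_vars_goal_trm)
  next
    case (2 k)
    then have "GCon k \<in> ?W"
      by (intro skolem_terms_subset_universe GCon_in_skolem_terms) (simp add: instance_consts_def)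
    then show ?thesis
      by (simp add: r 2 simps)
  next
    case (3 ax)
    show ?thesis
      unfolding r using 3(1)
      by (intro confined_axm_rules[OF 3(2) i N ex]) (force simp: instance_consts_def)+
  next
    case 4
    then show ?thesis
      by (auto simp: r simps)
  next
    case 5
    then show ?thesis
      by (auto simp: r simps P_gp_def)
  next
    case 6
    then show ?thesis
      by (auto simp: r simps P_eq_def)
  next
    case 7
    then show ?thesis
      by (auto simp: r simps P_c_def Let_def)
  qed
qed

theorem proposition6:
  fixes A :: abduction and i :: nat and ord :: "gtrm rel"
  assumes "abduction_instance A"
    and "strict_linear_order_on UNIV ord"
    and "i \<ge> 1"
  shows "finite_program (grnd ord (P_BwdA_P i A))"
proof -
  \<comment> \<open>3 is the width of \<open>c\<close> terms; the sum dominates the width of every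
    \<open>l\<close> term.\<close>
  define N where "N = 3 + (\<Sum>ax \<in> ab_axioms A. length (ex_vars ax))"
  have "length (ex_vars ax) \<le> N" if "ax \<in> ab_axioms A" for ax
    using that assms(1) member_le_sum[of ax "ab_axioms A" "\<lambda>ax. length (ex_vars ax)"]
    by (simp add: N_def abduction_instance_def)
  moreover have "3 \<le> N"
    by (simp add: N_def)
  ultimately have "confined ord (universe (instance_consts A) N i) r" if "r \<in> P_BwdA_P i A" for r
    using that assms(3) by (intro confined_P_BwdA_P)
  moreover have "finite (P_BwdA_P i A)"
    using finite_P_BwdA[OF assms(1)] by (simp add: P_BwdA_P_def)
  ultimately show ?thesis
    using finite_universe[OF finite_instance_consts[OF assms(1)]] by (intro finite_program_grnd)
qed

end
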